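(* Let $n\ge 1$ and let $C\subseteq\mathfrak{S}_n$ be a conjugacy class. Then $C$ is symmetric, i.e. $Q(C)=\sum_{\pi\in C}F_{\mathrm{Des}(\pi),n}$ is a symmetric function.
   Context: $[n]=\{1,\dots,n\}$ and $\mathfrak{S}_n$ is the symmetric group on $[n]$. For $\pi\in\mathfrak{S}_n$, $\mathrm{Des}(\pi)=\{i\in[n-1]:\pi_i>\pi_{i+1}\}$. For $J=\{j_1<\dots<j_s\}\subseteq[n-1]$, $\mathrm{co}(J)=(j_1,j_2-j_1,\dots,j_s-j_{s-1},n-j_s)$, a composition of $n$. For a composition $\alpha=(\alpha_1,\dots,\alpha_p)$ of $n$, $M_\alpha=\sum_{i_1<\cdots<i_p}x_{i_1}^{\alpha_1}\cdots x_{i_p}^{\alpha_p}$ (variables $x_1,x_2,\dots$) and $F_\alpha=\sum_{\beta\le\alpha}M_\beta$ over all refinements $\beta$ of $\alpha$ (including $\alpha$). $F_{J,n}:=F_{\mathrm{co}(J)}$. A symmetric function is a bounded-degree formal power series invariant under all permutations of the variables. *)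

theory Defs
  imports "HOL-Combinatorics.Permutations" "HOL-Library.Poly_Mapping"
begin

section \<open>Formal power series in countably many variables\<close>

text \<open>
  A monomial is a finitely supported exponent vector, and a formal power series with integer
  coefficients is an arbitrary function from monomials to coefficients. The variables
  $x_1, x_2, \ldots$ are indexed from 0: index i stands for $x_{i+1}$.
\<close>

type_synonym monomial = "nat \<Rightarrow>\<^sub>0 nat"

type_synonym power_series = "monomial \<Rightarrow> int"

definition total_degree :: "monomial \<Rightarrow> nat" where
  "total_degree m = (\<Sum>i\<in>Poly_Mapping.keys m. Poly_Mapping.lookup m i)"

definition bounded_degree :: "power_series \<Rightarrow> bool" where
  "bounded_degree f \<longleftrightarrow> (\<exists>d. \<forall>m. f m \<noteq> 0 \<longrightarrow> total_degree m \<le> d)"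

text \<open>
  For a bijection s, \<^term>\<open>Poly_Mapping.map_key s m\<close> is the monomial whose exponent at i is the
  exponent of m at s i, that is, m with its variables permuted by the inverse of s.
\<close>

definition symmetric_function :: "power_series \<Rightarrow> bool" where
  "symmetric_function f \<longleftrightarrow>
     bounded_degree f \<and> (\<forall>s. bij s \<longrightarrow> (\<forall>m. f (Poly_Mapping.map_key s m) = f m))"


section \<open>Compositions and quasisymmetric functions\<close>

definition is_composition :: "nat list \<Rightarrow> nat \<Rightarrow> bool" where
  "is_composition \<alpha> n \<longleftrightarrow> (\<forall>a\<in>set \<alpha>. 0 < a) \<and> sum_list \<alpha> = n"

text \<open>A refinement of \<alpha> replaces each part of \<alpha>, in place, by a composition of that part.\<close>

definition refines :: "nat list \<Rightarrow> nat list \<Rightarrow> bool" where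
  "refines \<beta> \<alpha> \<longleftrightarrow> (\<exists>\<gamma>s. \<beta> = concat \<gamma>s \<and> list_all2 is_composition \<gamma>s \<alpha>)"

lemma finite_refinements: "finite {\<beta>. refines \<beta> \<alpha>}"
proof -
  have comp: "set \<gamma> \<subseteq> {..n} \<and> length \<gamma> \<le> n" if "is_composition \<gamma> n" for \<gamma> n
    using that by (induction \<gamma> arbitrary: n) (fastforce simp: is_composition_def)+
  have "finite {\<gamma>. is_composition \<gamma> n}" for n
    by (rule finite_subset[OF _ finite_lists_length_le[of "{..n}" n]]) (use comp in auto)
  then have "finite {\<gamma>s. list_all2 is_composition \<gamma>s \<alpha>}"
  proof (induction \<alpha>)
    case (Cons a \<alpha>)
    have "{\<gamma>s. list_all2 is_composition \<gamma>s (a # \<alpha>)} =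
        (\<lambda>(\<gamma>, \<gamma>s). \<gamma> # \<gamma>s) ` ({\<gamma>. is_composition \<gamma> a} \<times> {\<gamma>s. list_all2 is_composition \<gamma>s \<alpha>})"
      by (auto simp: list_all2_Cons2)
    then show ?case using Cons by simp
  qed simp
  moreover have "{\<beta>. refines \<beta> \<alpha>} = concat ` {\<gamma>s. list_all2 is_composition \<gamma>s \<alpha>}"
    by (auto simp: refines_def)
  ultimately show ?thesis by simp
qed

text \<open>The monomial with exponent \<alpha> ! k at the variable with index is ! k.\<close>

definition monomial_of :: "nat list \<Rightarrow> nat list \<Rightarrow> monomial" where
  "monomial_of is \<alpha> = sum_list (map2 Poly_Mapping.single is \<alpha>)"

text \<open>
  The coefficient of m counts the terms of the defining sum that are equal to m. When all parts of
  \<alpha> are positive there is at most one, since the index list is then the sorted support of m.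
\<close>

definition monomial_qsym :: "nat list \<Rightarrow> power_series" where
  "monomial_qsym \<alpha> m =
     int (card {is. length is = length \<alpha> \<and> sorted_wrt (<) is \<and> monomial_of is \<alpha> = m})"

definition fundamental_qsym :: "nat list \<Rightarrow> power_series" where
  "fundamental_qsym \<alpha> m = (\<Sum>\<beta> | refines \<beta> \<alpha>. monomial_qsym \<beta> m)"

definition co :: "nat \<Rightarrow> nat set \<Rightarrow> nat list" where
  "co n J = (let js = sorted_list_of_set J in map2 (-) (js @ [n]) (0 # js))"


section \<open>Descents and conjugacy classes of the symmetric group\<close>

definition Des :: "nat \<Rightarrow> (nat \<Rightarrow> nat) \<Rightarrow> nat set" where
  "Des n \<pi> = {i \<in> {1..n - 1}. \<pi> i > \<pi> (i + 1)}"

definition Q :: "nat \<Rightarrow> (nat \<Rightarrow> nat) set \<Rightarrow> power_series" where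
  "Q n C m = (\<Sum>\<pi>\<in>C. fundamental_qsym (co n (Des n \<pi>)) m)"

definition is_conjugacy_class :: "nat \<Rightarrow> (nat \<Rightarrow> nat) set \<Rightarrow> bool" where
  "is_conjugacy_class n C \<longleftrightarrow>
     (\<exists>\<pi>. \<pi> permutes {1..n} \<and> C = {\<sigma> \<circ> \<pi> \<circ> inv \<sigma> | \<sigma>. \<sigma> permutes {1..n}})"

end

theory Submission
  imports Defs "HOL-Library.List_Lexorder" "HOL-Combinatorics.Orbits" "HOL-Combinatorics.Cycles"
begin

text \<open>
  Symmetry follows from an encoding of permutations by multisets of primitive necklaces, due to
  Gessel and Reutenauer. It is used here without introducing necklaces, as a statement about
  normal forms of labelled objects.

  Let \<open>m\<close> be a monomial of degree \<open>n\<close>, and let \<open>f\<close> be the unique weakly increasing word of length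
  \<open>n\<close> in which each letter \<open>v\<close> occurs as often as the variable \<open>v\<close> in \<open>m\<close>. The exponents of \<open>m\<close>
  refine the descent composition of \<open>\<pi>\<close> iff \<open>\<pi>\<close> is increasing on each block of equal letters of \<open>f\<close>.
  Hence the coefficient of \<open>m\<close> counts the \<open>\<pi> \<in> C\<close> that are increasing on the blocks of \<open>f\<close>
  (\<open>Q_eq_card\<close>); such a pair \<open>(\<pi>, f)\<close> is called a normal form below.

  Consider now all pairs \<open>(\<sigma>, g)\<close> of a permutation and a word, up to simultaneous relabelling of the
  positions, and attach to a position \<open>i\<close> its itinerary \<open>g i, g (\<sigma> i), g (\<sigma> (\<sigma> i)), \<dots>\<close>. Call a pair
  primitive if different positions on one cycle have different itineraries. Three facts are proved:
  a normal form is primitive (\<open>normal_form_primitive\<close>); each primitive pair can be relabelled to a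
  normal form, by sorting the positions by their itineraries (\<open>normal_form_exists\<close>); and a normal form
  is determined by its relabelling class (\<open>normal_form_unique\<close>). So the coefficient of \<open>m\<close> is the
  number of relabelling classes of primitive pairs with \<open>\<sigma> \<in> C\<close> in which \<open>g\<close> has the letters
  prescribed by \<open>m\<close>.

  Membership in \<open>C\<close> is invariant under relabelling, because relabelling conjugates \<open>\<sigma>\<close>, and
  neither primitivity nor relabelling refers to the order of the letters. A permutation of the
  variables therefore maps these classes bijectively to those of the permuted monomial. Concretely,
  permuting the letters of a normal form and normalizing again is an injection
  (\<open>card_increasing_on_blocks_le\<close>). This gives one inequality between the two coefficients, and
  the inverse permutation gives the other.
\<close>

section \<open>Itineraries and uniqueness of normal forms\<close>

definition increasing_on_blocks :: "nat \<Rightarrow> (nat \<Rightarrow> nat) \<Rightarrow> (nat \<Rightarrow> nat) \<Rightarrow> bool" where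
  "increasing_on_blocks n f \<sigma> \<longleftrightarrow>
     (\<forall>i\<in>{1..n}. \<forall>j\<in>{1..n}. i < j \<and> f i = f j \<longrightarrow> \<sigma> i < \<sigma> j)"

text \<open>
  The beginning of the periodic word read off from \<^term>\<open>f\<close> along the cycle of \<^term>\<open>i\<close>. Cutting
  the infinite word to finite length makes it a list, for which the lexicographic order is linear.
\<close>

primrec itinerary :: "(nat \<Rightarrow> nat) \<Rightarrow> (nat \<Rightarrow> nat) \<Rightarrow> nat \<Rightarrow> nat \<Rightarrow> nat list" where
  "itinerary \<sigma> f 0 i = []"
| "itinerary \<sigma> f (Suc k) i = f i # itinerary \<sigma> f k (\<sigma> i)"

lemma itinerary_less_mono:
  "itinerary \<sigma> f k i < itinerary \<sigma> f k j \<Longrightarrow> k \<le> l \<Longrightarrow> itinerary \<sigma> f l i < itinerary \<sigma> f l j"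
proof (induction k arbitrary: i j l)
  case (Suc k)
  then obtain l' where "l = Suc l'" "k \<le> l'" by (cases l) auto
  with Suc show ?case by auto
qed simp

text \<open>
  In a normal form the positions are sorted by their itineraries: if the first letters of two
  positions agree, then both lie in one block, so \<^term>\<open>\<sigma>\<close> keeps their order and the comparison
  moves on to the next letters.
\<close>

lemma mono_on_itinerary:
  assumes \<sigma>: "\<sigma> permutes {1..n}" and f: "mono_on {1..n} f"
    and inc: "increasing_on_blocks n f \<sigma>"
  shows "mono_on {1..n} (itinerary \<sigma> f k)"
proof -
  have "itinerary \<sigma> f k i \<le> itinerary \<sigma> f k j" if "i \<in> {1..n}" "j \<in> {1..n}" "i \<le> j" for i j
    using that
  proof (induction k arbitrary: i j)
    case (Suc k)
    have le: "f i \<le> f j" using f Suc.prems by (simp add: mono_on_def)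
    have "\<sigma> i \<le> \<sigma> j" if "f i = f j"
      using inc that Suc.prems unfolding increasing_on_blocks_def
      by (cases "i = j") (auto intro: less_imp_le)
    then have "itinerary \<sigma> f k (\<sigma> i) \<le> itinerary \<sigma> f k (\<sigma> j)" if "f i = f j"
      using that Suc.IH[of "\<sigma> i" "\<sigma> j"] Suc.prems permutes_in_image[OF \<sigma>] by blast
    then show ?case using le by auto
  qed simp
  then show ?thesis by (auto simp: mono_on_def)
qed

text \<open>
  A finite multiset can be sorted in only one way. The sublevel sets of a monotone function on an
  interval are initial segments, so they are determined by their sizes.
\<close>

lemma mono_on_rearrangement_unique:
  fixes h h' :: "nat \<Rightarrow> 'a::linorder"
  assumes h: "mono_on {1..n} h" and h': "mono_on {1..n} h'" and \<tau>: "\<tau> permutes {1..n}"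
    and eq: "\<And>i. i \<in> {1..n} \<Longrightarrow> h' (\<tau> i) = h i" and i: "i \<in> {1..n}"
  shows "h i = h' i"
proof -
  let ?D = "\<lambda>v. {j\<in>{1..n}. h j \<le> v}" and ?D' = "\<lambda>v. {j\<in>{1..n}. h' j \<le> v}"
  have "?D v = ?D' v" for v
  proof -
    have "?D' v = \<tau> ` ?D v"
    proof (intro set_eqI iffI)
      fix j assume j: "j \<in> ?D' v"
      then obtain i where "j = \<tau> i" "i \<in> {1..n}"
        using permutes_image[OF \<tau>] by blast
      then show "j \<in> \<tau> ` ?D v" using j eq by auto
    next
      fix j assume "j \<in> \<tau> ` ?D v"
      then obtain i where "j = \<tau> i" "i \<in> {1..n}" "h i \<le> v" by blast
      then show "j \<in> ?D' v"
        using eq permutes_in_image[OF \<tau>] by simp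
    qed
    then have card: "card (?D' v) = card (?D v)"
      by (simp only: card_image[OF permutes_inj_on[OF \<tau>]])
    have "?D v \<subseteq> ?D' v \<or> ?D' v \<subseteq> ?D v"
    proof (rule ccontr)
      assume "\<not> ?thesis"
      then obtain a b where "a \<in> ?D v" "a \<notin> ?D' v" "b \<in> ?D' v" "b \<notin> ?D v" by blast
      then show False using h h' unfolding mono_on_def
        by (smt (verit) dual_order.trans linorder_le_cases mem_Collect_eq)
    qed
    then show ?thesis using card card_subset_eq[of "?D v" "?D' v"] card_subset_eq[of "?D' v" "?D v"]
      by auto
  qed
  then have "h i \<le> v \<longleftrightarrow> h' i \<le> v" for v using i by blast
  then show ?thesis by (meson antisym order_refl)
qed

definition same_itinerary :: "(nat \<Rightarrow> nat) \<Rightarrow> (nat \<Rightarrow> nat) \<Rightarrow> nat \<Rightarrow> nat \<Rightarrow> bool" where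
  "same_itinerary \<sigma> f i j \<longleftrightarrow> (\<forall>k. itinerary \<sigma> f k i = itinerary \<sigma> f k j)"

lemma same_itinerary_step:
  "same_itinerary \<sigma> f i j \<longleftrightarrow> f i = f j \<and> same_itinerary \<sigma> f (\<sigma> i) (\<sigma> j)"
proof -
  have "same_itinerary \<sigma> f i j \<longleftrightarrow> (\<forall>k. itinerary \<sigma> f (Suc k) i = itinerary \<sigma> f (Suc k) j)"
    unfolding same_itinerary_def by (metis itinerary.simps(1) not0_implies_Suc)
  then show ?thesis by (auto simp: same_itinerary_def)
qed

lemma same_itinerary_funpow:
  "same_itinerary \<sigma> f i j \<Longrightarrow> same_itinerary \<sigma> f ((\<sigma> ^^ k) i) ((\<sigma> ^^ k) j)"
  by (induction k) (auto dest: same_itinerary_step[THEN iffD1])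

text \<open>
  Agreement after one step implies agreement now because itineraries are periodic: some positive
  power of \<^term>\<open>\<sigma>\<close> is the identity, so the starting points are reached again further along.
\<close>

lemma same_itinerary_image_iff:
  assumes "\<sigma> permutes {1..n::nat}"
  shows "same_itinerary \<sigma> f (\<sigma> i) (\<sigma> j) \<longleftrightarrow> same_itinerary \<sigma> f i j"
proof
  assume *: "same_itinerary \<sigma> f (\<sigma> i) (\<sigma> j)"
  have perm: "permutation \<sigma>"
    using assms permutation_permutes by auto
  then obtain k where k: "(\<sigma> ^^ k) = id" "k > 0"
    using permutation_is_nilpotent[of \<sigma>] by auto
  then have id: "(\<sigma> ^^ (k - 1)) (\<sigma> x) = x" for x
    by (metis Suc_pred' comp_apply funpow_Suc_right id_apply)
  from same_itinerary_funpow[OF *, of "k - 1"] show "same_itinerary \<sigma> f i j"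
    unfolding id .
qed (use same_itinerary_step in blast)

text \<open>
  Within a class of positions with equal itineraries \<^term>\<open>\<sigma>\<close> is increasing, and it maps this class
  onto the class of \<^term>\<open>\<sigma> i\<close>. So the position of \<^term>\<open>\<sigma> i\<close> in its class is the position of
  \<^term>\<open>i\<close> in its own: the itineraries alone determine \<^term>\<open>\<sigma>\<close>.
\<close>

lemma card_below_image:
  assumes \<sigma>: "\<sigma> permutes {1..n}" and inc: "increasing_on_blocks n f \<sigma>" and i: "i \<in> {1..n}"
  shows "card {j\<in>{1..n}. same_itinerary \<sigma> f j (\<sigma> i) \<and> j < \<sigma> i} =
         card {j\<in>{1..n}. same_itinerary \<sigma> f j i \<and> j < i}" (is "card ?B = card ?A")
proof -
  have strict: "\<sigma> a < \<sigma> b \<longleftrightarrow> a < b"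
    if "same_itinerary \<sigma> f a b" "a \<in> {1..n}" "b \<in> {1..n}" for a b
  proof -
    have "f a = f b" using that same_itinerary_step by blast
    then show ?thesis
      using inc that unfolding increasing_on_blocks_def by (metis less_asym linorder_neqE_nat)
  qed
  have "?B = \<sigma> ` ?A"
  proof (intro set_eqI iffI)
    fix b assume b: "b \<in> ?B"
    then obtain a where "b = \<sigma> a" "a \<in> {1..n}"
      using permutes_image[OF \<sigma>] by blast
    then show "b \<in> \<sigma> ` ?A"
      using b strict[of a i] i by (auto simp: same_itinerary_image_iff[OF \<sigma>])
  next
    fix b assume "b \<in> \<sigma> ` ?A"
    then obtain a where "b = \<sigma> a" "a \<in> ?A" by blast
    then show "b \<in> ?B"
      using strict[of a i] i permutes_in_image[OF \<sigma>]
      by (auto simp: same_itinerary_image_iff[OF \<sigma>])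
  qed
  then show ?thesis
    by (simp only: card_image[OF permutes_inj_on[OF \<sigma>]])
qed

text \<open>
  Two normal forms that differ by the relabelling \<^term>\<open>\<tau>\<close> have the same multiset of itineraries.
  Both list it in sorted order, hence they have the same itinerary at every position, and the
  permutation is recovered from the itineraries. The relabelling itself need not be the identity,
  as it may exchange cycles that carry the same word.
\<close>

lemma normal_form_unique:
  assumes \<sigma>: "\<sigma> permutes {1..n}" and \<sigma>': "\<sigma>' permutes {1..n}" and \<tau>: "\<tau> permutes {1..n}"
    and f: "mono_on {1..n} f"
    and inc: "increasing_on_blocks n f \<sigma>" and inc': "increasing_on_blocks n f \<sigma>'"
    and f\<tau>: "\<And>i. i \<in> {1..n} \<Longrightarrow> f (\<tau> i) = f i"
    and conj: "\<And>i. i \<in> {1..n} \<Longrightarrow> \<tau> (\<sigma> i) = \<sigma>' (\<tau> i)"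
  shows "\<sigma> = \<sigma>'"
proof
  fix i
  show "\<sigma> i = \<sigma>' i"
  proof (cases "i \<in> {1..n}")
    case True
    have *: "itinerary \<sigma>' f k (\<tau> i) = itinerary \<sigma> f k i" if "i \<in> {1..n}" for k i
      using that
    proof (induction k arbitrary: i)
      case (Suc k)
      then show ?case using Suc.IH[of "\<sigma> i"] f\<tau>[of i] conj[of i] permutes_in_image[OF \<sigma>, of i]
        by simp
    qed simp
    have same: "itinerary \<sigma> f k i = itinerary \<sigma>' f k i" if "i \<in> {1..n}" for k i
      using mono_on_rearrangement_unique[OF mono_on_itinerary[OF \<sigma> f inc]
        mono_on_itinerary[OF \<sigma>' f inc'] \<tau> *] that by simp
    have in_n: "\<sigma> i \<in> {1..n}" "\<sigma>' i \<in> {1..n}"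
      using True permutes_in_image[OF \<sigma>] permutes_in_image[OF \<sigma>'] by auto
    have same': "same_itinerary \<sigma>' f a b \<longleftrightarrow> same_itinerary \<sigma> f a b"
      if "a \<in> {1..n}" "b \<in> {1..n}" for a b
      using that same by (simp add: same_itinerary_def)
    have eq: "same_itinerary \<sigma> f (\<sigma>' i) (\<sigma> i)"
      unfolding same_itinerary_def
    proof
      fix k
      have "itinerary \<sigma>' f (Suc k) i = itinerary \<sigma> f (Suc k) i" using same True by metis
      then show "itinerary \<sigma> f k (\<sigma>' i) = itinerary \<sigma> f k (\<sigma> i)" using same in_n by simp
    qed
    define K where "K = {j\<in>{1..n}. same_itinerary \<sigma> f j (\<sigma> i)}"
    have K': "{j\<in>{1..n}. same_itinerary \<sigma> f j (\<sigma>' i)} = K"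
      using eq unfolding K_def same_itinerary_def by auto
    have "card {j\<in>K. j < \<sigma> i} = card {j\<in>{1..n}. same_itinerary \<sigma> f j i \<and> j < i}"
      using card_below_image[OF \<sigma> inc True] by (simp add: K_def conj_assoc)
    also have "\<dots> = card {j\<in>{1..n}. same_itinerary \<sigma>' f j i \<and> j < i}"
      using same' True by (intro arg_cong[where f = card]) auto
    also have "\<dots> = card {j\<in>K. j < \<sigma>' i}"
    proof -
      have "{j\<in>{1..n}. same_itinerary \<sigma>' f j (\<sigma>' i) \<and> j < \<sigma>' i} = {j\<in>K. j < \<sigma>' i}"
        using same' in_n unfolding K'[symmetric] by auto
      then show ?thesis using card_below_image[OF \<sigma>' inc' True] by simp
    qed
    finally have card: "card {j\<in>K. j < \<sigma> i} = card {j\<in>K. j < \<sigma>' i}" .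
    have "finite K" and mem: "\<sigma> i \<in> K" "\<sigma>' i \<in> K"
      using in_n eq by (auto simp: K_def same_itinerary_def)
    have less: "card {j\<in>K. j < a} < card {j\<in>K. j < b}" if "a < b" "a \<in> K" for a b
      using that \<open>finite K\<close> by (intro psubset_card_mono) auto
    show ?thesis
    proof (rule linorder_cases[of "\<sigma> i" "\<sigma>' i"])
      assume "\<sigma> i < \<sigma>' i"
      from less[OF this mem(1)] show ?thesis using card by linarith
    next
      assume "\<sigma>' i < \<sigma> i"
      from less[OF this mem(2)] show ?thesis using card by linarith
    qed
  next
    case False
    then show ?thesis using \<sigma> \<sigma>' by (simp add: permutes_not_in)
  qed
qed

section \<open>Existence of normal forms for primitive pairs\<close>
text \<open>
  If \<^term>\<open>j = (\<sigma> ^^ k) i\<close> had the itinerary of \<^term>\<open>i < j\<close>, then \<^term>\<open>\<sigma>\<close> and all its powers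
  would keep the pair in order, so \<^term>\<open>\<sigma> ^^ k\<close> would move every point of the cycle strictly
  upwards, which is impossible for its maximum. If \<^term>\<open>j < i\<close>, the minimum gives the contradiction.
\<close>

lemma normal_form_primitive:
  assumes \<sigma>: "\<sigma> permutes {1..n}" and inc: "increasing_on_blocks n f \<sigma>" and i: "i \<in> {1..n}"
    and j: "j \<in> orbit \<sigma> i" and same: "same_itinerary \<sigma> f i j"
  shows "j = i"
proof (rule ccontr)
  assume neq: "j \<noteq> i"
  have perm: "permutation \<sigma>"
    using \<sigma> permutation_permutes by auto
  have in_n: "(\<sigma> ^^ l) x \<in> {1..n}" if "x \<in> {1..n}" for l x
    by (induction l) (use that permutes_in_image[OF \<sigma>] in simp_all)
  obtain k where k: "j = (\<sigma> ^^ k) i"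
    using j by (auto simp: orbit_altdef)
  have j_n: "j \<in> {1..n}" using k in_n i by blast
  have strict: "(\<sigma> ^^ l) a < (\<sigma> ^^ l) b"
    if "a < b" "same_itinerary \<sigma> f a b" "a \<in> {1..n}" "b \<in> {1..n}" for l a b
  proof (induction l)
    case (Suc l)
    have "f ((\<sigma> ^^ l) a) = f ((\<sigma> ^^ l) b)"
      using same_itinerary_funpow[OF that(2)] same_itinerary_step by blast
    with Suc inc in_n[OF that(3), of l] in_n[OF that(4), of l] show ?case
      unfolding increasing_on_blocks_def by auto
  qed (use that in simp)
  have shift: "(\<sigma> ^^ l) j = (\<sigma> ^^ k) ((\<sigma> ^^ l) i)" for l
    by (simp add: k funpow_add[symmetric, THEN fun_cong, simplified] add.commute)
  define Orb where "Orb = orbit \<sigma> i"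
  have Orb: "finite Orb" "Orb \<noteq> {}"
    using perm by (auto simp: Orb_def permutation_self_in_orbit finite_orbit orbit_nonempty)
  have O_funpow: "(\<sigma> ^^ l) x \<in> Orb" if "x \<in> Orb" for l x
    using that unfolding Orb_def by (induction l) (auto intro: orbit.step)
  have O_ex: "\<exists>l. x = (\<sigma> ^^ l) i" if "x \<in> Orb" for x
    using that by (auto simp: Orb_def orbit_altdef)
  show False
  proof (cases "i < j")
    case True
    obtain l where l: "Max Orb = (\<sigma> ^^ l) i" using O_ex Max_in[OF Orb] by blast
    have "Max Orb < (\<sigma> ^^ k) (Max Orb)"
      using strict[OF True same i j_n, of l] by (simp add: l shift)
    moreover have "(\<sigma> ^^ k) (Max Orb) \<le> Max Orb"
      using Max_in[OF Orb] O_funpow Orb by simp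
    ultimately show False by simp
  next
    case False
    obtain l where l: "Min Orb = (\<sigma> ^^ l) i" using O_ex Min_in[OF Orb] by blast
    have "same_itinerary \<sigma> f j i" using same by (simp add: same_itinerary_def)
    then have "(\<sigma> ^^ k) (Min Orb) < Min Orb"
      using strict[of j i l] i j_n False neq by (simp add: l shift)
    moreover have "Min Orb \<le> (\<sigma> ^^ k) (Min Orb)"
      using Min_in[OF Orb] O_funpow Orb by simp
    ultimately show False by simp
  qed
qed

lemma rank_permutation:
  fixes less :: "nat \<Rightarrow> nat \<Rightarrow> bool"
  assumes "irreflp less" "transp less" "totalp_on {1..n} less"
  obtains \<tau> where "\<tau> permutes {1..n}"
    "\<And>i j. i \<in> {1..n} \<Longrightarrow> j \<in> {1..n} \<Longrightarrow> \<tau> i < \<tau> j \<longleftrightarrow> less i j"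
proof
  note irrefl = irreflpD[OF assms(1)] and trans = transpD[OF assms(2)]
    and total = totalp_onD[OF assms(3)]
  \<comment> \<open>Counting \<^term>\<open>i\<close> itself makes the ranks start at 1; the identity elsewhere is forced by
    the notion of a permutation of the interval.\<close>
  define \<tau> where
    "\<tau> i = (if i \<in> {1..n} then card {j\<in>{1..n}. j = i \<or> less j i} else i)" for i
  have \<tau>: "\<tau> i = card {j\<in>{1..n}. j = i \<or> less j i}" if "i \<in> {1..n}" for i
    using that by (simp only: \<tau>_def if_True)
  have mono: "\<tau> i < \<tau> j" if "less i j" "i \<in> {1..n}" "j \<in> {1..n}" for i j
  proof -
    have "j \<notin> {k\<in>{1..n}. k = i \<or> less k i}" "j \<in> {k\<in>{1..n}. k = j \<or> less k j}"
      using that irrefl trans by blast+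
    moreover have "{k\<in>{1..n}. k = i \<or> less k i} \<subseteq> {k\<in>{1..n}. k = j \<or> less k j}"
      using that trans by blast
    ultimately have "{k\<in>{1..n}. k = i \<or> less k i} \<subset> {k\<in>{1..n}. k = j \<or> less k j}"
      by blast
    then show ?thesis unfolding \<tau>[OF that(2)] \<tau>[OF that(3)]
      by (intro psubset_card_mono) simp_all
  qed
  show iff: "\<tau> i < \<tau> j \<longleftrightarrow> less i j" if "i \<in> {1..n}" "j \<in> {1..n}" for i j
    using mono[of i j] mono[of j i] total[of i j] that by (metis less_asym' less_irrefl)
  have inj: "inj_on \<tau> {1..n}"
    by (rule inj_onI) (metis iff total less_irrefl)
  have "\<tau> i \<in> {1..n}" if i: "i \<in> {1..n}" for i
  proof -
    have "card {i} \<le> \<tau> i" unfolding \<tau>[OF i] using i by (intro card_mono) auto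
    moreover have "\<tau> i \<le> card {1..n}" unfolding \<tau>[OF i] by (intro card_mono) auto
    ultimately show ?thesis by simp
  qed
  then have "\<tau> ` {1..n} = {1..n}"
    using inj by (intro endo_inj_surj) auto
  then have "bij_betw \<tau> {1..n} {1..n}" using inj by (simp add: bij_betw_def)
  then show "\<tau> permutes {1..n}"
    by (rule bij_imp_permutes) (simp only: \<tau>_def if_False)
qed

text \<open>
  Sort the positions by their itineraries, breaking ties by the minimum of the cycle. On one cycle
  there are no ties by primitivity, so this is a strict total order. The first letter is its leading
  key, so the relabelled word is weakly increasing. For positions with equal first letters, passing
  to the images under \<^term>\<open>\<sigma>\<close> drops this letter and keeps the cycles, hence keeps the order.
\<close>

lemma normal_form_exists:
  assumes \<sigma>: "\<sigma> permutes {1..n}"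
    and primitive: "\<And>i j. i \<in> {1..n} \<Longrightarrow> j \<in> orbit \<sigma> i \<Longrightarrow> same_itinerary \<sigma> g i j \<Longrightarrow> j = i"
  obtains \<tau> where "\<tau> permutes {1..n}" "mono_on {1..n} (g \<circ> inv \<tau>)"
    "increasing_on_blocks n (g \<circ> inv \<tau>) (\<tau> \<circ> \<sigma> \<circ> inv \<tau>)"
proof -
  have perm: "permutation \<sigma>"
    using \<sigma> permutation_permutes by auto
  define cyc where "cyc i = Min (orbit \<sigma> i)" for i
  have cyc_image: "cyc (\<sigma> i) = cyc i" for i
    by (simp add: cyc_def permutation_orbit_step[OF perm])
  define less where "less i j \<longleftrightarrow> (\<exists>k. itinerary \<sigma> g k i < itinerary \<sigma> g k j) \<or>
      same_itinerary \<sigma> g i j \<and> cyc i < cyc j" for i j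
  have less_image: "less (\<sigma> i) (\<sigma> j)" if "less i j" "g i = g j" for i j
  proof -
    consider k where "itinerary \<sigma> g k i < itinerary \<sigma> g k j"
      | "same_itinerary \<sigma> g i j" "cyc i < cyc j"
      using \<open>less i j\<close> less_def by blast
    then show ?thesis
    proof cases
      case 1
      then obtain k' where "k = Suc k'" by (cases k) auto
      with 1 \<open>g i = g j\<close> show ?thesis by (auto simp: less_def)
    next
      case 2
      then show ?thesis by (simp add: less_def cyc_image same_itinerary_step[of \<sigma> g i j])
    qed
  qed
  have g_less: "less i j" if "g i < g j" for i j
  proof -
    have "itinerary \<sigma> g 1 i < itinerary \<sigma> g 1 j" using that by simp
    then show ?thesis unfolding less_def by blast
  qed
  have irreflp: "irreflp less" by (simp add: less_def irreflp_def)
  have less_trans: "transp less"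
  proof (rule transpI)
    fix i j k assume that: "less i j" "less j k"
    have *: "\<exists>l. itinerary \<sigma> g l i < itinerary \<sigma> g l k"
      if "itinerary \<sigma> g k1 i < itinerary \<sigma> g k1 j" "itinerary \<sigma> g k2 j < itinerary \<sigma> g k2 k" for k1 k2
      using itinerary_less_mono[OF that(1), of "max k1 k2"]
        itinerary_less_mono[OF that(2), of "max k1 k2"] by (auto intro: less_trans)
    from that show "less i k"
      unfolding less_def
      by (elim disjE exE conjE) (auto simp: same_itinerary_def dest: *)
  qed
  have less_total: "totalp_on {1..n} less"
  proof (rule totalp_onI)
    fix i j assume that: "i \<in> {1..n}" "i \<noteq> j"
    show "less i j \<or> less j i"
    proof (cases "same_itinerary \<sigma> g i j")
      case True
      have "cyc i \<noteq> cyc j"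
      proof
        assume eq: "cyc i = cyc j"
        have mem: "cyc x \<in> orbit \<sigma> x" for x
          unfolding cyc_def using perm
          by (intro Min_in finite_orbit permutation_self_in_orbit orbit_nonempty)
        have "j \<in> orbit \<sigma> (cyc i)"
          unfolding eq using orbit_swap[OF permutation_self_in_orbit[OF perm] mem] .
        then have "j \<in> orbit \<sigma> i" using mem[of i] by (rule orbit_trans)
        then show False using primitive that True by blast
      qed
      then show ?thesis using True by (auto simp: less_def same_itinerary_def)
    next
      case False
      then show ?thesis unfolding less_def same_itinerary_def by (meson linorder_neqE)
    qed
  qed
  obtain \<tau> where \<tau>: "\<tau> permutes {1..n}"
    and \<tau>_less: "\<And>i j. i \<in> {1..n} \<Longrightarrow> j \<in> {1..n} \<Longrightarrow> \<tau> i < \<tau> j \<longleftrightarrow> less i j"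
    using rank_permutation[OF irreflp less_trans less_total] by blast
  have inv_n: "inv \<tau> i \<in> {1..n}" if "i \<in> {1..n}" for i
    using that permutes_in_image[OF permutes_inv[OF \<tau>]] by blast
  have \<tau>_inv: "\<tau> (inv \<tau> i) = i" "inv \<tau> (\<tau> i) = i" for i
    using \<tau> by (simp_all add: permutes_inverses)
  have less_inv: "less (inv \<tau> i) (inv \<tau> j)" if "i < j" "i \<in> {1..n}" "j \<in> {1..n}" for i j
    using \<tau>_less[OF inv_n[OF that(2)] inv_n[OF that(3)]] \<open>i < j\<close> by (simp add: \<tau>_inv)
  have "mono_on {1..n} (g \<circ> inv \<tau>)"
  proof (intro mono_onI)
    fix i j assume ij: "i \<in> {1..n}" "j \<in> {1..n}" "i \<le> j"
    show "(g \<circ> inv \<tau>) i \<le> (g \<circ> inv \<tau>) j"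
    proof (rule ccontr)
      assume "\<not> ?thesis"
      then have "g (inv \<tau> j) < g (inv \<tau> i)" by simp
      from g_less[OF this] show False
        using \<tau>_less[of "inv \<tau> j" "inv \<tau> i"] inv_n ij by (simp add: \<tau>_inv)
    qed
  qed
  moreover have "increasing_on_blocks n (g \<circ> inv \<tau>) (\<tau> \<circ> \<sigma> \<circ> inv \<tau>)"
    unfolding increasing_on_blocks_def
  proof (intro ballI impI)
    fix i j assume ij: "i \<in> {1..n}" "j \<in> {1..n}" "i < j \<and> (g \<circ> inv \<tau>) i = (g \<circ> inv \<tau>) j"
    then have "less (\<sigma> (inv \<tau> i)) (\<sigma> (inv \<tau> j))"
      using less_image less_inv by simp
    then show "(\<tau> \<circ> \<sigma> \<circ> inv \<tau>) i < (\<tau> \<circ> \<sigma> \<circ> inv \<tau>) j"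
      using \<tau>_less[of "\<sigma> (inv \<tau> i)" "\<sigma> (inv \<tau> j)"] inv_n ij permutes_in_image[OF \<sigma>] by simp
  qed
  ultimately show thesis using that \<tau> by blast
qed

section \<open>Sorted words with prescribed content\<close>
definition has_content :: "nat \<Rightarrow> (nat \<Rightarrow> nat) \<Rightarrow> monomial \<Rightarrow> bool" where
  "has_content n f m \<longleftrightarrow> (\<forall>v. card {i\<in>{1..n}. f i = v} = Poly_Mapping.lookup m v)"

definition degree_below :: "monomial \<Rightarrow> nat \<Rightarrow> nat" where
  "degree_below m v = (\<Sum>u<v. Poly_Mapping.lookup m u)"

lemma total_degree_eq_degree_below:
  obtains v where "total_degree m = degree_below m v"
proof
  let ?v = "Suc (Max (Poly_Mapping.keys m))"
  have "Poly_Mapping.keys m \<subseteq> {..<?v}"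
    by (simp add: le_imp_less_Suc subset_iff)
  then show "total_degree m = degree_below m ?v"
    unfolding total_degree_def degree_below_def
    by (intro sum.mono_neutral_left) (auto simp: in_keys_iff)
qed

lemma degree_below_le_total_degree: "degree_below m v \<le> total_degree m"
proof -
  have "degree_below m v = (\<Sum>u\<in>{..<v} \<inter> Poly_Mapping.keys m. Poly_Mapping.lookup m u)"
    unfolding degree_below_def by (intro sum.mono_neutral_right) (auto simp: in_keys_iff)
  also have "\<dots> \<le> total_degree m"
    unfolding total_degree_def by (intro sum_mono2) auto
  finally show ?thesis .
qed

text \<open>
  The positions with letter below \<^term>\<open>v\<close> form an initial segment, and its length can be read off
  from the content.
\<close>

lemma sorted_word_less_iff:
  assumes f: "mono_on {1..n} f" and content: "has_content n f m" and i: "i \<in> {1..n}"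
  shows "f i < v \<longleftrightarrow> i \<le> degree_below m v"
proof -
  define D where "D = {j\<in>{1..n}. f j < v}"
  have "D = (\<Union>u\<in>{..<v}. {j\<in>{1..n}. f j = u})"
    by (auto simp: D_def)
  also have "card \<dots> = (\<Sum>u<v. card {j\<in>{1..n}. f j = u})"
    by (intro card_UN_disjoint) auto
  finally have card: "card D = degree_below m v"
    using content by (simp add: has_content_def degree_below_def)
  show ?thesis
  proof (cases "f i < v")
    case True
    have "f j < v" if "j \<in> {1..i}" for j
      using mono_onD[OF f _ i, of j] that i True by auto
    then have "{1..i} \<subseteq> D" using i by (auto simp: D_def)
    then have "card {1..i} \<le> card D" by (intro card_mono) (auto simp: D_def)
    with True card show ?thesis by simp
  next
    case False
    have "j < i" if "j \<in> D" for j
    proof (rule ccontr)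
      assume "\<not> j < i"
      then have "f i \<le> f j" using mono_onD[OF f i, of j] that by (auto simp: D_def)
      with that False show False by (auto simp: D_def)
    qed
    then have "D \<subseteq> {1..<i}" by (auto simp: D_def)
    then have "card D \<le> card {1..<i}" by (intro card_mono) auto
    with False card i show ?thesis by auto
  qed
qed

lemma sorted_word_unique:
  assumes "mono_on {1..n} f" "has_content n f m" "mono_on {1..n} g" "has_content n g m"
    and "i \<in> {1..n}"
  shows "f i = g i"
  using sorted_word_less_iff[OF assms(1,2,5)] sorted_word_less_iff[OF assms(3,4,5)]
  by (metis linorder_neqE_nat less_irrefl)

text \<open>
  The word is obtained by solving the characterisation of \<open>sorted_word_less_iff\<close> for \<^term>\<open>f i\<close>.
\<close>

lemma sorted_word_exists:
  assumes "total_degree m = n"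
  obtains f where "mono_on {1..n} f" "has_content n f m"
proof
  define f where "f i = (LEAST v. i \<le> degree_below m (Suc v))" for i
  have mono: "degree_below m u \<le> degree_below m v" if "u \<le> v" for u v
    using that unfolding degree_below_def by (intro sum_mono2) auto
  have less_iff: "f i < v \<longleftrightarrow> i \<le> degree_below m v" if i: "i \<in> {1..n}" for i v
  proof -
    obtain w where w: "n = degree_below m w"
      using total_degree_eq_degree_below[of m] assms by metis
    then have "i \<le> degree_below m (Suc w)" using i mono[of w "Suc w"] by auto
    then have f: "i \<le> degree_below m (Suc (f i))" unfolding f_def by (rule LeastI)
    show ?thesis
    proof
      assume "f i < v"
      then show "i \<le> degree_below m v" using f mono[of "Suc (f i)" v] by simp
    next
      assume v: "i \<le> degree_below m v"
      then obtain v' where "v = Suc v'" using i by (cases v) (auto simp: degree_below_def)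
      then show "f i < v" using v Least_le[of "\<lambda>v. i \<le> degree_below m (Suc v)" v']
        by (simp add: f_def)
    qed
  qed
  show "mono_on {1..n} f"
  proof (rule mono_onI)
    fix i j assume "i \<in> {1..n}" "j \<in> {1..n}" "i \<le> j"
    then show "f i \<le> f j"
      using less_iff[of j "Suc (f j)"] less_iff[of i "Suc (f j)"] by simp
  qed
  show "has_content n f m"
    unfolding has_content_def
  proof
    fix v
    have "{i\<in>{1..n}. f i = v} = {degree_below m v<..degree_below m (Suc v)}" (is "?A = ?B")
    proof (intro set_eqI iffI)
      fix i assume "i \<in> ?A"
      then show "i \<in> ?B" using less_iff[of i v] less_iff[of i "Suc v"] by auto
    next
      fix i assume i: "i \<in> ?B"
      then have "i \<in> {1..n}"
        using degree_below_le_total_degree[of m "Suc v"] assms by auto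
      then show "i \<in> ?A" using i less_iff[of i v] less_iff[of i "Suc v"] by auto
    qed
    then show "card {i\<in>{1..n}. f i = v} = Poly_Mapping.lookup m v"
      by (simp add: degree_below_def)
  qed
qed

lemma sorted_word_jump_iff:
  assumes f: "mono_on {1..n} f" and content: "has_content n f m" and i: "i \<in> {1..n - 1}"
  shows "f i < f (i + 1) \<longleftrightarrow> (\<exists>v. degree_below m v = i)"
proof -
  have iff: "f i < v \<longleftrightarrow> i \<le> degree_below m v" "f (i + 1) < v \<longleftrightarrow> i + 1 \<le> degree_below m v" for v
    using sorted_word_less_iff[OF f content] i by auto
  show ?thesis
  proof
    assume "f i < f (i + 1)"
    then have "degree_below m (f (i + 1)) = i" using iff[of "f (i + 1)"] by simp
    then show "\<exists>v. degree_below m v = i" by blast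
  next
    assume "\<exists>v. degree_below m v = i"
    then obtain v where "degree_below m v = i" by blast
    then show "f i < f (i + 1)" using iff[of v] by simp
  qed
qed

lemma increasing_on_blocks_iff_Des:
  assumes \<pi>: "\<pi> permutes {1..n}" and f: "mono_on {1..n} f"
  shows "increasing_on_blocks n f \<pi> \<longleftrightarrow> Des n \<pi> \<subseteq> {i. f i < f (i + 1)}"
proof
  assume inc: "increasing_on_blocks n f \<pi>"
  show "Des n \<pi> \<subseteq> {i. f i < f (i + 1)}"
  proof
    fix i assume "i \<in> Des n \<pi>"
    then have i: "i \<in> {1..n}" "i + 1 \<in> {1..n}" "\<pi> (i + 1) < \<pi> i" by (auto simp: Des_def)
    then have "f i \<le> f (i + 1)" "f i \<noteq> f (i + 1)"
      using mono_onD[OF f i(1,2)] inc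
      unfolding increasing_on_blocks_def by (auto dest: less_asym bspec)
    then show "i \<in> {i. f i < f (i + 1)}" by simp
  qed
next
  assume des: "Des n \<pi> \<subseteq> {i. f i < f (i + 1)}"
  have "\<pi> i < \<pi> j" if "i \<in> {1..n}" "j \<in> {1..n}" "i < j" "f i = f j" for i j
    using that
  proof (induction j)
    case (Suc j)
    have j: "j \<in> {1..n}" "i \<le> j" using Suc.prems by auto
    have "f i \<le> f j" "f j \<le> f (Suc j)"
      using mono_onD[OF f, of i j] mono_onD[OF f, of j "Suc j"] Suc.prems j by auto
    then have eq: "f i = f j" "f j = f (Suc j)" using Suc.prems by auto
    have "j \<notin> Des n \<pi>" using des eq by auto
    then have "\<pi> j \<le> \<pi> (Suc j)" using Suc.prems j by (auto simp: Des_def)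
    moreover have "\<pi> j \<noteq> \<pi> (Suc j)" using permutes_inj[OF \<pi>] by (metis injD n_not_Suc_n)
    ultimately have "\<pi> j < \<pi> (Suc j)" by simp
    then show ?case using Suc.IH Suc.prems j eq by (cases "i = j") auto
  qed simp
  then show "increasing_on_blocks n f \<pi>" unfolding increasing_on_blocks_def by blast
qed

section \<open>Coefficients of the fundamental quasisymmetric functions\<close>

definition exponents :: "monomial \<Rightarrow> nat list" where
  "exponents m = map (Poly_Mapping.lookup m) (sorted_list_of_set (Poly_Mapping.keys m))"

lemma lookup_monomial_of:
  assumes "length is = length \<beta>" "distinct is"
  shows "map (Poly_Mapping.lookup (monomial_of is \<beta>)) is = \<beta>"
    and "v \<notin> set is \<Longrightarrow> Poly_Mapping.lookup (monomial_of is \<beta>) v = 0"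
proof -
  have *: "Poly_Mapping.lookup (monomial_of is \<beta>) v = 0" if "v \<notin> set is" for v "is" \<beta>
    using that
  proof (induction "is" arbitrary: \<beta>)
    case (Cons i "is")
    then show ?case
      by (cases \<beta>) (auto simp: monomial_of_def lookup_add lookup_single when_def)
  qed (simp add: monomial_of_def)
  then show "v \<notin> set is \<Longrightarrow> Poly_Mapping.lookup (monomial_of is \<beta>) v = 0" .
  show "map (Poly_Mapping.lookup (monomial_of is \<beta>)) is = \<beta>"
    using assms
  proof (induction "is" \<beta> rule: list_induct2)
    case (Cons i "is" b \<beta>)
    have "monomial_of (i # is) (b # \<beta>) = Poly_Mapping.single i b + monomial_of is \<beta>"
      by (simp add: monomial_of_def)
    moreover have "map (Poly_Mapping.lookup (Poly_Mapping.single i b + monomial_of is \<beta>)) is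
        = map (Poly_Mapping.lookup (monomial_of is \<beta>)) is"
      by (rule map_cong) (use Cons.prems in \<open>auto simp: lookup_add lookup_single when_def\<close>)
    moreover have "Poly_Mapping.lookup (Poly_Mapping.single i b + monomial_of is \<beta>) i = b"
      using *[of i "is" \<beta>] Cons.prems by (simp add: lookup_add)
    ultimately show ?case
      using Cons by (simp del: map_eq_conv)
  qed simp
qed

text \<open>
  An increasing list of indices that produces the monomial must be its sorted support, because
  positive exponents make every listed variable occur.
\<close>

lemma monomial_qsym_eq:
  assumes pos: "\<forall>b\<in>set \<beta>. 0 < b"
  shows "monomial_qsym \<beta> m = of_bool (\<beta> = exponents m)"
proof -
  let ?ks = "sorted_list_of_set (Poly_Mapping.keys m)"
  have "length is = length \<beta> \<and> sorted_wrt (<) is \<and> monomial_of is \<beta> = m \<longleftrightarrow>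
      is = ?ks \<and> \<beta> = exponents m" for "is"
  proof (intro iffI; elim conjE)
    assume len: "length is = length \<beta>" and sorted: "sorted_wrt (<) is" and m: "monomial_of is \<beta> = m"
    have dist: "distinct is" using sorted strict_sorted_iff by blast
    have map: "map (Poly_Mapping.lookup m) is = \<beta>"
      using lookup_monomial_of(1)[OF len dist] m by simp
    have "Poly_Mapping.keys m = set is"
    proof (intro set_eqI iffI)
      fix v assume "v \<in> set is"
      then have "Poly_Mapping.lookup m v \<in> set \<beta>" unfolding map[symmetric] by simp
      then show "v \<in> Poly_Mapping.keys m" using pos by (auto simp: in_keys_iff)
    next
      fix v assume "v \<in> Poly_Mapping.keys m"
      then show "v \<in> set is" using lookup_monomial_of(2)[OF len dist, of v] m
        by (auto simp: in_keys_iff)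
    qed
    then have "is = ?ks" using sorted
      by (metis sorted_list_of_set.idem_if_sorted_distinct strict_sorted_iff)
    then show "is = ?ks \<and> \<beta> = exponents m" using map by (simp add: exponents_def)
  next
    assume is_eq: "is = ?ks" and \<beta>: "\<beta> = exponents m"
    then have len: "length is = length \<beta>" and dist: "distinct is" and set: "set is = Poly_Mapping.keys m"
      by (simp_all add: exponents_def)
    have map: "map (Poly_Mapping.lookup (monomial_of is \<beta>)) is = map (Poly_Mapping.lookup m) is"
      using lookup_monomial_of(1)[OF len dist] is_eq \<beta> by (simp add: exponents_def)
    have "monomial_of is \<beta> = m"
    proof (rule poly_mapping_eqI)
      fix v
      show "Poly_Mapping.lookup (monomial_of is \<beta>) v = Poly_Mapping.lookup m v"
      proof (cases "v \<in> set is")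
        case True
        then show ?thesis using map by (simp only: map_eq_conv)
      next
        case False
        then show ?thesis using lookup_monomial_of(2)[OF len dist] set by (auto simp: in_keys_iff)
      qed
    qed
    moreover have "sorted_wrt (<) is" using is_eq by simp
    ultimately show "length is = length \<beta> \<and> sorted_wrt (<) is \<and> monomial_of is \<beta> = m"
      using len by blast
  qed
  then have "monomial_qsym \<beta> m = int (card {is. is = ?ks \<and> \<beta> = exponents m})"
    by (simp add: monomial_qsym_def)
  then show ?thesis by (cases "\<beta> = exponents m") auto
qed

lemma refines_Cons:
  "refines \<beta> (a # \<alpha>) \<longleftrightarrow> (\<exists>\<gamma> \<beta>'. \<beta> = \<gamma> @ \<beta>' \<and> is_composition \<gamma> a \<and> refines \<beta>' \<alpha>)"
proof
  assume "refines \<beta> (a # \<alpha>)"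
  then obtain \<gamma> \<gamma>s where "\<beta> = \<gamma> @ concat \<gamma>s" "is_composition \<gamma> a" "list_all2 is_composition \<gamma>s \<alpha>"
    by (auto simp: refines_def list_all2_Cons2)
  then show "\<exists>\<gamma> \<beta>'. \<beta> = \<gamma> @ \<beta>' \<and> is_composition \<gamma> a \<and> refines \<beta>' \<alpha>"
    unfolding refines_def by blast
next
  assume "\<exists>\<gamma> \<beta>'. \<beta> = \<gamma> @ \<beta>' \<and> is_composition \<gamma> a \<and> refines \<beta>' \<alpha>"
  then obtain \<gamma> \<gamma>s where "\<beta> = concat (\<gamma> # \<gamma>s)" "list_all2 is_composition (\<gamma> # \<gamma>s) (a # \<alpha>)"
    unfolding refines_def by auto
  then show "refines \<beta> (a # \<alpha>)"
    unfolding refines_def by blast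
qed

lemma refines_positive: "refines \<beta> \<alpha> \<Longrightarrow> b \<in> set \<beta> \<Longrightarrow> 0 < b"
proof (induction \<alpha> arbitrary: \<beta>)
  case (Cons a \<alpha>)
  from Cons.prems(1) obtain \<gamma> \<beta>'
    where "\<beta> = \<gamma> @ \<beta>'" "is_composition \<gamma> a" "refines \<beta>' \<alpha>"
    unfolding refines_Cons by blast
  then show ?case using Cons.IH[of \<beta>'] Cons.prems(2) by (auto simp: is_composition_def)
qed (simp add: refines_def)

lemma fundamental_qsym_eq: "fundamental_qsym \<alpha> m = of_bool (refines (exponents m) \<alpha>)"
proof -
  have "fundamental_qsym \<alpha> m = (\<Sum>\<beta> | refines \<beta> \<alpha>. of_bool (\<beta> = exponents m))"
    unfolding fundamental_qsym_def
    by (intro sum.cong refl monomial_qsym_eq) (auto dest: refines_positive)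
  also have "\<dots> = of_bool (refines (exponents m) \<alpha>)"
    using finite_refinements[of \<alpha>] by (simp add: of_bool_def sum.delta')
  finally show ?thesis .
qed

text \<open>
  A refinement is cut at the partial sum that hits the first element \<^term>\<open>j\<close> of the list, and
  its tail refines the remaining gaps, counted from \<^term>\<open>j\<close>. This is why the induction needs an
  arbitrary left end \<^term>\<open>a\<close>, although descent sets only use 0.
\<close>

lemma refines_gaps_iff:
  assumes "sorted_wrt (<) (a # js @ [n])"
  shows "refines \<beta> (map2 (-) (js @ [n]) (a # js)) \<longleftrightarrow>
    is_composition \<beta> (n - a) \<and> (\<forall>j\<in>set js. \<exists>k. a + sum_list (take k \<beta>) = j)"
  using assms
proof (induction js arbitrary: a \<beta>)
  case Nil
  have "refines \<beta>' [] \<longleftrightarrow> \<beta>' = []" for \<beta>' by (simp add: refines_def)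
  then show ?case by (simp add: refines_Cons)
next
  case (Cons j js)
  have aj: "a < j" "j < n" and js: "sorted_wrt (<) (j # js @ [n])" using Cons.prems by auto
  have "refines \<beta> (map2 (-) ((j # js) @ [n]) (a # j # js)) \<longleftrightarrow>
      (\<exists>\<gamma> \<beta>'. \<beta> = \<gamma> @ \<beta>' \<and> is_composition \<gamma> (j - a) \<and> is_composition \<beta>' (n - j) \<and>
        (\<forall>i\<in>set js. \<exists>k. j + sum_list (take k \<beta>') = i))"
    using Cons.IH[OF js] by (simp add: refines_Cons)
  also have "\<dots> \<longleftrightarrow> is_composition \<beta> (n - a) \<and>
      (\<forall>i\<in>set (j # js). \<exists>k. a + sum_list (take k \<beta>) = i)"
  proof (intro iffI; elim exE conjE)
    fix \<gamma> \<beta>' assume \<beta>: "\<beta> = \<gamma> @ \<beta>'" and \<gamma>: "is_composition \<gamma> (j - a)"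
      and \<beta>': "is_composition \<beta>' (n - j)" and ks: "\<forall>i\<in>set js. \<exists>k. j + sum_list (take k \<beta>') = i"
    have "a + sum_list (take (length \<gamma>) \<beta>) = j"
      using \<beta> \<gamma> aj by (simp add: is_composition_def)
    moreover have "\<exists>k. a + sum_list (take k \<beta>) = i" if i: "i \<in> set js" for i
    proof -
      obtain k where "j + sum_list (take k \<beta>') = i" using ks i by blast
      then have "a + sum_list (take (length \<gamma> + k) \<beta>) = i"
        using \<beta> \<gamma> aj by (simp add: is_composition_def)
      then show ?thesis by (rule exI)
    qed
    moreover have "is_composition \<beta> (n - a)"
      using \<beta> \<gamma> \<beta>' aj by (auto simp: is_composition_def)
    ultimately show "is_composition \<beta> (n - a) \<and>
        (\<forall>i\<in>set (j # js). \<exists>k. a + sum_list (take k \<beta>) = i)" by auto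
  next
    assume \<beta>: "is_composition \<beta> (n - a)"
      and ks: "\<forall>i\<in>set (j # js). \<exists>k. a + sum_list (take k \<beta>) = i"
    then obtain k where k: "a + sum_list (take k \<beta>) = j" by auto
    have "sum_list (take k \<beta>) + sum_list (drop k \<beta>) = sum_list \<beta>"
      by (metis append_take_drop_id sum_list_append)
    then have "is_composition (take k \<beta>) (j - a)" "is_composition (drop k \<beta>) (n - j)"
      using \<beta> k aj by (auto simp: is_composition_def dest: in_set_takeD in_set_dropD)
    moreover have "\<exists>l. j + sum_list (take l (drop k \<beta>)) = i" if i: "i \<in> set js" for i
    proof -
      obtain l where l: "a + sum_list (take l \<beta>) = i"
        using ks i by auto
      have split: "take (p + q) \<beta> = take p \<beta> @ take q (drop p \<beta>)" for p q
        by (rule take_add)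
      have "j < i" using js i by simp
      have "k \<le> l"
      proof (rule ccontr)
        assume "\<not> k \<le> l"
        then have "sum_list (take k \<beta>) \<ge> sum_list (take l \<beta>)"
          using split[of l "k - l"] by simp
        then show False using k l \<open>j < i\<close> by simp
      qed
      then have "j + sum_list (take (l - k) (drop k \<beta>)) = i"
        using split[of k "l - k"] k l by simp
      then show ?thesis by (rule exI)
    qed
    ultimately show "\<exists>\<gamma> \<beta>'. \<beta> = \<gamma> @ \<beta>' \<and> is_composition \<gamma> (j - a) \<and> is_composition \<beta>' (n - j) \<and>
        (\<forall>i\<in>set js. \<exists>k. j + sum_list (take k \<beta>') = i)"
      by (intro exI[of _ "take k \<beta>"] exI[of _ "drop k \<beta>"]) simp
  qed
  finally show ?case .
qed

lemma refines_co_iff: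
  assumes "J \<subseteq> {1..n - 1}" "n \<ge> 1"
  shows "refines \<beta> (co n J) \<longleftrightarrow>
    is_composition \<beta> n \<and> (\<forall>j\<in>J. \<exists>k. sum_list (take k \<beta>) = j)"
proof -
  have fin: "finite J" using assms finite_subset by blast
  have "sorted_wrt (<) (0 # sorted_list_of_set J @ [n])"
    using assms fin by (fastforce simp: sorted_wrt_append)
  from refines_gaps_iff[OF this, of \<beta>] show ?thesis
    using fin by (simp add: co_def Let_def)
qed

lemma sum_list_exponents: "sum_list (exponents m) = total_degree m"
  unfolding exponents_def total_degree_def
  by (simp add: sum_list_distinct_conv_sum_set)

lemma partial_sum_exponents_iff:
  "(\<exists>k. sum_list (take k (exponents m)) = j) \<longleftrightarrow> (\<exists>v. degree_below m v = j)"
proof -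
  define ks where "ks = sorted_list_of_set (Poly_Mapping.keys m)"
  have ks: "sorted_wrt (<) ks" "distinct ks" "set ks = Poly_Mapping.keys m"
    by (simp_all add: ks_def)
  have take_sum: "sum_list (take k (exponents m)) = (\<Sum>u\<in>set (take k ks). Poly_Mapping.lookup m u)" for k
    using ks by (simp add: exponents_def ks_def[symmetric] take_map sum_list_distinct_conv_sum_set)
  have below: "degree_below m v = (\<Sum>u\<in>{u\<in>set ks. u < v}. Poly_Mapping.lookup m u)" for v
    unfolding degree_below_def ks(3)
    by (intro sum.mono_neutral_right) (auto simp: in_keys_iff)
  show ?thesis
  proof
    assume "\<exists>k. sum_list (take k (exponents m)) = j"
    then obtain k where k: "sum_list (take k (exponents m)) = j" by blast
    have "\<exists>v. set (take k ks) = {u\<in>set ks. u < v}"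
    proof (cases "k < length ks")
      case True
      have less_iff: "ks ! i < ks ! k \<longleftrightarrow> i < k" if "i < length ks" for i
        using True ks(1) that by (metis less_asym linorder_neqE_nat sorted_wrt_iff_nth_less)
      have "set (take k ks) = (!) ks ` {0..<k}" "set ks = (!) ks ` {0..<length ks}"
        using True nth_image[of k ks] nth_image[of "length ks" ks] by simp_all
      then have "set (take k ks) = {u\<in>set ks. u < ks ! k}"
        using less_iff True by auto
      then show ?thesis by blast
    next
      case False
      have "set ks \<subseteq> {..Max (set ks)}" by auto
      then have "set (take k ks) = {u\<in>set ks. u < Suc (Max (set ks))}"
        using False by (auto simp: less_Suc_eq_le)
      then show ?thesis by blast
    qed
    then show "\<exists>v. degree_below m v = j" using k take_sum below by metis
  next
    assume "\<exists>v. degree_below m v = j"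
    then obtain v where v: "degree_below m v = j" by blast
    have "set (takeWhile (\<lambda>u. u < v) xs) = {u\<in>set xs. u < v}" if "sorted_wrt (<) xs" for xs
      using that by (induction xs) auto
    then have "set (takeWhile (\<lambda>u. u < v) ks) = {u\<in>set ks. u < v}" using ks by simp
    then have "sum_list (take (length (takeWhile (\<lambda>u. u < v) ks)) (exponents m)) = j"
      using take_sum below v takeWhile_eq_take by metis
    then show "\<exists>k. sum_list (take k (exponents m)) = j" by blast
  qed
qed

lemma exponents_positive: "b \<in> set (exponents m) \<Longrightarrow> 0 < b"
  by (auto simp: exponents_def in_keys_iff)

lemma Des_subset: "Des n \<pi> \<subseteq> {1..n - 1}"
  by (auto simp: Des_def)

lemma Q_eq_0:
  assumes "n \<ge> 1" "total_degree m \<noteq> n"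
  shows "Q n C m = 0"
proof -
  have "\<not> refines (exponents m) (co n (Des n \<pi>))" for \<pi>
    using refines_co_iff[OF Des_subset, of n "exponents m"] assms
    by (simp add: is_composition_def sum_list_exponents)
  then show ?thesis by (simp add: Q_def fundamental_qsym_eq)
qed

text \<open>
  The exponents of \<^term>\<open>m\<close> refine the descent composition exactly if all descents are jumps of the
  sorted word with content \<^term>\<open>m\<close>. So each permutation contributes 0 or 1, and the contributing
  ones are those that form a normal form together with this word.
\<close>

lemma Q_eq_card:
  assumes n: "n \<ge> 1" and deg: "total_degree m = n"
    and f: "mono_on {1..n} f" and content: "has_content n f m"
    and C: "\<And>\<pi>. \<pi> \<in> C \<Longrightarrow> \<pi> permutes {1..n}"
  shows "Q n C m = int (card {\<pi>\<in>C. increasing_on_blocks n f \<pi>})"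
proof -
  have fin: "finite C"
    using finite_subset[of C "{\<pi>. \<pi> permutes {1..n}}"] C by (auto simp: finite_permutations)
  have "refines (exponents m) (co n (Des n \<pi>)) \<longleftrightarrow> increasing_on_blocks n f \<pi>" if "\<pi> \<in> C" for \<pi>
  proof -
    have "refines (exponents m) (co n (Des n \<pi>)) \<longleftrightarrow> (\<forall>j\<in>Des n \<pi>. \<exists>v. degree_below m v = j)"
      using refines_co_iff[OF Des_subset n] deg exponents_positive
      by (auto simp: is_composition_def sum_list_exponents partial_sum_exponents_iff)
    also have "\<dots> \<longleftrightarrow> (\<forall>j\<in>Des n \<pi>. f j < f (j + 1))"
      using sorted_word_jump_iff[OF f content] Des_subset by blast
    also have "\<dots> \<longleftrightarrow> increasing_on_blocks n f \<pi>"
      using increasing_on_blocks_iff_Des[OF C[OF that] f] by blast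
    finally show ?thesis .
  qed
  then have "Q n C m = (\<Sum>\<pi>\<in>C. of_bool (increasing_on_blocks n f \<pi>))"
    unfolding Q_def fundamental_qsym_eq by (intro sum.cong) auto
  also have "\<dots> = int (card {\<pi>\<in>C. increasing_on_blocks n f \<pi>})"
    by (simp add: of_bool_def sum.inter_filter[OF fin, symmetric])
  finally show ?thesis .
qed

section \<open>Permuting the variables\<close>
lemma lookup_map_key: "inj s \<Longrightarrow> Poly_Mapping.lookup (Poly_Mapping.map_key s m) v = Poly_Mapping.lookup m (s v)"
  by (simp add: map_key.rep_eq)

lemma total_degree_map_key:
  assumes "bij s"
  shows "total_degree (Poly_Mapping.map_key s m) = total_degree m"
proof -
  have "bij_betw s (s -` Poly_Mapping.keys m) (Poly_Mapping.keys m)"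
    using assms by (auto simp: bij_betw_def bij_def inj_on_def surj_image_vimage_eq)
  from sum.reindex_bij_betw[OF this, of "Poly_Mapping.lookup m"] show ?thesis
    using bij_is_inj[OF assms] by (simp add: total_degree_def keys_map_key lookup_map_key)
qed

lemma itinerary_comp: "itinerary \<sigma> (h \<circ> f) k i = map h (itinerary \<sigma> f k i)"
  by (induction k arbitrary: i) simp_all

lemma same_itinerary_comp:
  assumes "inj h"
  shows "same_itinerary \<sigma> (h \<circ> f) i j \<longleftrightarrow> same_itinerary \<sigma> f i j"
  unfolding same_itinerary_def itinerary_comp using assms by (simp add: inj_map_eq_map)

lemma increasing_on_blocks_cong:
  assumes "\<And>i. i \<in> {1..n} \<Longrightarrow> f i = g i"
  shows "increasing_on_blocks n f \<pi> \<longleftrightarrow> increasing_on_blocks n g \<pi>"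
  using assms unfolding increasing_on_blocks_def by metis

text \<open>
  Applying a bijection to the letters leaves the pair primitive, since it does not change which
  itineraries agree. The new pair therefore has a normal form, whose word is the sorted one.
\<close>

lemma renormalize:
  assumes \<pi>: "\<pi> permutes {1..n}" and inc: "increasing_on_blocks n f \<pi>"
    and content: "has_content n f m" and s: "bij s"
    and f': "mono_on {1..n} f'" and content': "has_content n f' (Poly_Mapping.map_key s m)"
  shows "\<exists>\<tau>. \<tau> permutes {1..n} \<and> (\<forall>i\<in>{1..n}. f' (\<tau> i) = inv s (f i)) \<and>
    increasing_on_blocks n f' (\<tau> \<circ> \<pi> \<circ> inv \<tau>)"
proof -
  have inj_inv: "inj (inv s)" and s_inv: "s (inv s v) = v" "inv s (s v) = v" for v
    using s by (simp_all add: bij_imp_bij_inv bij_is_inj bij_is_surj surj_f_inv_f)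
  have "j = i" if "i \<in> {1..n}" "j \<in> orbit \<pi> i" "same_itinerary \<pi> (inv s \<circ> f) i j" for i j
    using normal_form_primitive[OF \<pi> inc] that same_itinerary_comp[OF inj_inv] by blast
  from normal_form_exists[OF \<pi> this] obtain \<tau> where \<tau>: "\<tau> permutes {1..n}"
    and mono: "mono_on {1..n} (inv s \<circ> f \<circ> inv \<tau>)"
    and inc': "increasing_on_blocks n (inv s \<circ> f \<circ> inv \<tau>) (\<tau> \<circ> \<pi> \<circ> inv \<tau>)"
    by blast
  have \<tau>_inv: "\<tau> (inv \<tau> i) = i" "inv \<tau> (\<tau> i) = i" for i
    using \<tau> by (simp_all add: permutes_inverses)
  have "has_content n (inv s \<circ> f \<circ> inv \<tau>) (Poly_Mapping.map_key s m)"
    unfolding has_content_def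
  proof
    fix v
    have "{i\<in>{1..n}. (inv s \<circ> f \<circ> inv \<tau>) i = v} = \<tau> ` {i\<in>{1..n}. f i = s v}" (is "?A = ?B")
    proof (intro set_eqI iffI)
      fix i assume i: "i \<in> ?A"
      then have "f (inv \<tau> i) = s v" by (auto simp: s_inv)
      with i have "inv \<tau> i \<in> {i\<in>{1..n}. f i = s v}"
        using permutes_in_image[OF permutes_inv[OF \<tau>], of i] by simp
      then show "i \<in> ?B" by (intro image_eqI[of i \<tau> "inv \<tau> i"]) (simp_all add: \<tau>_inv)
    next
      fix i assume "i \<in> ?B"
      then obtain j where "i = \<tau> j" "j \<in> {1..n}" "f j = s v" by blast
      then show "i \<in> ?A" using permutes_in_image[OF \<tau>, of j] by (simp add: \<tau>_inv s_inv)
    qed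
    then have "card ?A = card {i\<in>{1..n}. f i = s v}"
      by (simp only: card_image[OF permutes_inj_on[OF \<tau>]])
    also have "\<dots> = Poly_Mapping.lookup (Poly_Mapping.map_key s m) v"
      using content by (simp add: has_content_def lookup_map_key[OF bij_is_inj[OF s]])
    finally show "card ?A = Poly_Mapping.lookup (Poly_Mapping.map_key s m) v" .
  qed
  then have eq: "f' i = (inv s \<circ> f \<circ> inv \<tau>) i" if "i \<in> {1..n}" for i
    using sorted_word_unique[OF f' content' mono] that by blast
  have "f' (\<tau> i) = inv s (f i)" if "i \<in> {1..n}" for i
    using eq[of "\<tau> i"] permutes_in_image[OF \<tau>, of i] that by (simp add: \<tau>_inv)
  moreover have "increasing_on_blocks n f' (\<tau> \<circ> \<pi> \<circ> inv \<tau>)"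
    using inc' increasing_on_blocks_cong[of n f' "inv s \<circ> f \<circ> inv \<tau>", OF eq] by blast
  ultimately show ?thesis using \<tau> by blast
qed

text \<open>
  Renormalization is injective: if two normal forms become equal, then relabelling carries one to
  the other and fixes the original word, so they agree by \<open>normal_form_unique\<close>.
\<close>

lemma card_increasing_on_blocks_le:
  assumes C: "\<And>\<pi>. \<pi> \<in> C \<Longrightarrow> \<pi> permutes {1..n}"
    and closed: "\<And>\<pi> \<tau>. \<pi> \<in> C \<Longrightarrow> \<tau> permutes {1..n} \<Longrightarrow> \<tau> \<circ> \<pi> \<circ> inv \<tau> \<in> C"
    and f: "mono_on {1..n} f" and content: "has_content n f m" and s: "bij s"
    and f': "mono_on {1..n} f'" and content': "has_content n f' (Poly_Mapping.map_key s m)"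
  shows "card {\<pi>\<in>C. increasing_on_blocks n f \<pi>} \<le> card {\<pi>\<in>C. increasing_on_blocks n f' \<pi>}"
    (is "card ?A \<le> card ?B")
proof -
  have "\<forall>\<pi>\<in>?A. \<exists>\<tau>. \<tau> permutes {1..n} \<and> (\<forall>i\<in>{1..n}. f' (\<tau> i) = inv s (f i)) \<and>
      increasing_on_blocks n f' (\<tau> \<circ> \<pi> \<circ> inv \<tau>)"
    using renormalize[OF C _ content s f' content'] by blast
  then obtain T where T: "T \<pi> permutes {1..n}" "\<forall>i\<in>{1..n}. f' (T \<pi> i) = inv s (f i)"
    "increasing_on_blocks n f' (T \<pi> \<circ> \<pi> \<circ> inv (T \<pi>))" if "\<pi> \<in> ?A" for \<pi>
    unfolding bchoice_iff by blast
  define \<phi> where "\<phi> \<pi> = T \<pi> \<circ> \<pi> \<circ> inv (T \<pi>)" for \<pi>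
  have "inj_on \<phi> ?A"
  proof (rule inj_onI)
    fix \<pi>1 \<pi>2 assume \<pi>1: "\<pi>1 \<in> ?A" and \<pi>2: "\<pi>2 \<in> ?A" and eq: "\<phi> \<pi>1 = \<phi> \<pi>2"
    let ?\<tau> = "inv (T \<pi>2) \<circ> T \<pi>1"
    have \<tau>: "?\<tau> permutes {1..n}"
      using T(1)[OF \<pi>1] T(1)[OF \<pi>2] by (intro permutes_compose permutes_inv)
    have T_inv: "T \<pi>2 (inv (T \<pi>2) i) = i" "inv (T \<pi>2) (T \<pi>2 i) = i" "inv (T \<pi>1) (T \<pi>1 i) = i" for i
      using T(1)[OF \<pi>1] T(1)[OF \<pi>2] by (simp_all add: permutes_inverses)
    show "\<pi>1 = \<pi>2"
    proof (rule normal_form_unique[OF _ _ \<tau> f])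
      show "f (?\<tau> i) = f i" if i: "i \<in> {1..n}" for i
      proof -
        have "inv s (f (?\<tau> i)) = f' (T \<pi>2 (?\<tau> i))"
          using T(2)[OF \<pi>2] permutes_in_image[OF \<tau>, of i] i by auto
        also have "\<dots> = inv s (f i)"
          using T(2)[OF \<pi>1] i by (simp add: T_inv)
        finally show ?thesis using bij_is_inj[OF bij_imp_bij_inv[OF s]] by (simp add: inj_eq)
      qed
      show "?\<tau> (\<pi>1 i) = \<pi>2 (?\<tau> i)" for i
        using fun_cong[OF eq, of "T \<pi>1 i"] by (simp add: \<phi>_def T_inv)
    qed (use \<pi>1 \<pi>2 C in auto)
  qed
  moreover have "\<phi> ` ?A \<subseteq> ?B"
    using T closed by (auto simp: \<phi>_def)
  moreover have "finite ?B"
    using finite_subset[of ?B "{\<pi>. \<pi> permutes {1..n}}"] C by (auto simp: finite_permutations)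
  ultimately show ?thesis by (rule card_inj_on_le)
qed

theorem corollary3p5:
  fixes n :: nat and C :: "(nat \<Rightarrow> nat) set"
  assumes "n \<ge> 1"
    and "is_conjugacy_class n C"
  shows "symmetric_function (Q n C)"
proof -
  obtain \<pi>0 where \<pi>0: "\<pi>0 permutes {1..n}"
    and C_eq: "C = {\<sigma> \<circ> \<pi>0 \<circ> inv \<sigma> | \<sigma>. \<sigma> permutes {1..n}}"
    using assms(2) unfolding is_conjugacy_class_def by blast
  have C: "\<pi> permutes {1..n}" if \<pi>: "\<pi> \<in> C" for \<pi>
  proof -
    obtain \<sigma> where "\<pi> = \<sigma> \<circ> \<pi>0 \<circ> inv \<sigma>" and \<sigma>: "\<sigma> permutes {1..n}"
      using \<pi> C_eq by blast
    then show ?thesis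
      using permutes_compose[OF permutes_inv[OF \<sigma>] permutes_compose[OF \<pi>0 \<sigma>]] by simp
  qed
  have closed: "\<tau> \<circ> \<pi> \<circ> inv \<tau> \<in> C" if \<pi>: "\<pi> \<in> C" and \<tau>: "\<tau> permutes {1..n}" for \<pi> \<tau>
  proof -
    obtain \<sigma> where \<sigma>: "\<pi> = \<sigma> \<circ> \<pi>0 \<circ> inv \<sigma>" "\<sigma> permutes {1..n}"
      using \<pi> C_eq by blast
    have "inv (\<tau> \<circ> \<sigma>) = inv \<sigma> \<circ> inv \<tau>"
      using o_inv_distrib[of \<tau> \<sigma>] \<sigma>(2) \<tau> by (simp add: permutes_bij)
    then have "\<tau> \<circ> \<pi> \<circ> inv \<tau> = (\<tau> \<circ> \<sigma>) \<circ> \<pi>0 \<circ> inv (\<tau> \<circ> \<sigma>)"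
      by (simp add: \<sigma>(1) comp_assoc)
    then show ?thesis using permutes_compose[OF \<sigma>(2) \<tau>] unfolding C_eq by blast
  qed
  have Q_le: "Q n C m \<le> Q n C (Poly_Mapping.map_key s m)" if s: "bij s" for s m
  proof (cases "total_degree m = n")
    case True
    then have deg': "total_degree (Poly_Mapping.map_key s m) = n"
      using total_degree_map_key[OF s] by simp
    obtain f where f: "mono_on {1..n} f" "has_content n f m"
      using sorted_word_exists[OF True] by blast
    obtain f' where f': "mono_on {1..n} f'" "has_content n f' (Poly_Mapping.map_key s m)"
      using sorted_word_exists[OF deg'] by blast
    show ?thesis
      using card_increasing_on_blocks_le[OF C closed f s f']
      by (simp add: Q_eq_card[OF assms(1) True f C] Q_eq_card[OF assms(1) deg' f' C])
  next
    case False
    then show ?thesis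
      using Q_eq_0[OF assms(1)] total_degree_map_key[OF s] by simp
  qed
  have "Q n C (Poly_Mapping.map_key s m) = Q n C m" if s: "bij s" for s m
  proof -
    have "s \<circ> inv s = (\<lambda>x. x)"
      using bij_is_surj[OF s] by (auto simp: surj_f_inv_f)
    then have "Poly_Mapping.map_key (inv s) (Poly_Mapping.map_key s m) = m"
      using bij_is_inj[OF s] bij_is_inj[OF bij_imp_bij_inv[OF s]]
      by (simp add: map_key_compose map_key_id)
    then show ?thesis
      using Q_le[OF s, of m] Q_le[OF bij_imp_bij_inv[OF s], of "Poly_Mapping.map_key s m"] by simp
  qed
  moreover have "bounded_degree (Q n C)"
    unfolding bounded_degree_def using Q_eq_0[OF assms(1)] by (metis order_refl)
  ultimately show ?thesis by (simp add: symmetric_function_def)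
qed

end
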